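(* Let $(M,p_0)$ be a based metric space that is Lipschitz path connected and has more than one element. If $p_0$ supports only trivial local representation, then the first Lipschitz homotopy group $\pi_1^{\mathrm{Lip}}(M,p_0)$ is a metric group with respect to the lifted metric $d_{\mathcal{P}}$ (restricted to $\pi_1^{\mathrm{Lip}}(M,p_0)\subset\mathcal{P}_M$).
   Context: All paths and loops are Lipschitz with domain $I=[0,1]$ (Euclidean metric); $\ell(\gamma)$ is the length of $\gamma$, $\overline{\gamma}$ the inverse path, $*$ concatenation. A metric space is Lipschitz path connected if any two points are joined by a Lipschitz path. $I\times I$ carries the $L^1$ metric. Two paths $\gamma,\gamma'$ in $M$ with the same initial points and the same end points are homotopic rel endpoints, $\gamma\simeq\gamma'$, if there is a Lipschitz map $H:I\times I\to M$ with $H|_{I\times\{0\}}=\gamma$, $H|_{I\times\{1\}}=\gamma'$, $H|_{\{0\}\times I}\equiv\gamma(0)$, $H|_{\{1\}\times I}\equiv\gamma(1)$; $[\gamma]$ denotes the class of $\gamma$. The first Lipschitz homotopy group $\pi_1^{\mathrm{Lip}}(M,p_0)$ is the set of classes of loops based at $p_0$ with group operation given by concatenation. The universal (Lipschitz) path space of $(M,p_0)$ is $\mathcal{P}_M=\{[\gamma] : \gamma:I\to M \text{ Lipschitz},\ \gamma(0)=p_0\}$, with lifted pseudo-metric $d_{\mathcal{P}}([\gamma_1],[\gamma_2])=\inf\{\ell(\beta):\beta\simeq\overline{\gamma_1}*\gamma_2\}$. A class $[\alpha]\in\pi_1^{\mathrm{Lip}}(M,p)$ is locally representable if for every neighborhood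 $U\subset M$ of $p$ there is a representative $\alpha_U\in[\alpha]$ with image contained in $U$. The point $p$ supports only trivial local representation if the only locally representable class in $\pi_1^{\mathrm{Lip}}(M,p)$ is the trivial class $[p]$. A metric group is a group equipped with a metric for which the group acts on itself isometrically by left multiplication (a left-invariant metric). *)

theory Defs
  imports "HOL-Analysis.Analysis" "HOL-Algebra.Group"
begin

text \<open>
  The metric space is a set \<open>M\<close> in an arbitrary type of class \<^class>\<open>metric_space\<close>, with the
  induced metric. Paths are functions on \<^typ>\<open>real\<close> of which only the values on \<open>[0,1]\<close> matter;
  functions that agree on \<open>[0,1]\<close> are homotopic, so classes do not depend on the values elsewhere.
\<close>

definition lip_path :: "'a::metric_space set \<Rightarrow> (real \<Rightarrow> 'a) \<Rightarrow> bool" where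
  "lip_path M \<gamma> \<longleftrightarrow> (\<exists>C. C-lipschitz_on {0..1} \<gamma>) \<and> path_image \<gamma> \<subseteq> M"

definition lip_path_connected :: "'a::metric_space set \<Rightarrow> bool" where
  "lip_path_connected M \<longleftrightarrow>
     (\<forall>x\<in>M. \<forall>y\<in>M. \<exists>\<gamma>. lip_path M \<gamma> \<and> pathstart \<gamma> = x \<and> pathfinish \<gamma> = y)"

text \<open>
  The supremum is taken in \<^typ>\<open>real\<close>. For a Lipschitz path the sums are bounded above by the
  Lipschitz constant, so there it is the usual length.
\<close>
definition path_length :: "(real \<Rightarrow> 'a::metric_space) \<Rightarrow> real" where
  "path_length \<gamma> = Sup {\<Sum>i<n. dist (\<gamma> (t i)) (\<gamma> (t (Suc i))) | (t :: nat \<Rightarrow> real) n.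
     t 0 = 0 \<and> t n = 1 \<and> (\<forall>i<n. t i \<le> t (Suc i))}"

text \<open>
  In \<open>H s t\<close> the path parameter is \<open>s\<close> and the homotopy parameter is \<open>t\<close>. The Lipschitz condition
  is written out for the \<open>L\<^sup>1\<close> metric because the product metric of the library is Euclidean.
\<close>
definition lip_homotopic ::
  "'a::metric_space set \<Rightarrow> (real \<Rightarrow> 'a) \<Rightarrow> (real \<Rightarrow> 'a) \<Rightarrow> bool" where
  "lip_homotopic M \<gamma> \<gamma>' \<longleftrightarrow>
     lip_path M \<gamma> \<and> lip_path M \<gamma>' \<and>
     pathstart \<gamma> = pathstart \<gamma>' \<and> pathfinish \<gamma> = pathfinish \<gamma>' \<and>
     (\<exists>H :: real \<Rightarrow> real \<Rightarrow> 'a.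
        (\<forall>s\<in>{0..1}. \<forall>t\<in>{0..1}. H s t \<in> M) \<and>
        (\<exists>C\<ge>0. \<forall>s\<in>{0..1}. \<forall>t\<in>{0..1}. \<forall>s'\<in>{0..1}. \<forall>t'\<in>{0..1}.
            dist (H s t) (H s' t') \<le> C * (\<bar>s - s'\<bar> + \<bar>t - t'\<bar>)) \<and>
        (\<forall>s\<in>{0..1}. H s 0 = \<gamma> s) \<and> (\<forall>s\<in>{0..1}. H s 1 = \<gamma>' s) \<and>
        (\<forall>t\<in>{0..1}. H 0 t = \<gamma> 0) \<and> (\<forall>t\<in>{0..1}. H 1 t = \<gamma> 1))"

definition lip_class :: "'a::metric_space set \<Rightarrow> (real \<Rightarrow> 'a) \<Rightarrow> (real \<Rightarrow> 'a) set" where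
  "lip_class M \<gamma> = {\<gamma>'. lip_homotopic M \<gamma> \<gamma>'}"

definition lip_path_space :: "'a::metric_space set \<Rightarrow> 'a \<Rightarrow> (real \<Rightarrow> 'a) set set" where
  "lip_path_space M p = {lip_class M \<gamma> | \<gamma>. lip_path M \<gamma> \<and> pathstart \<gamma> = p}"

text \<open>
  The value 0 outside the path space is a convention: the locale \<^locale>\<open>Metric_space\<close> requires
  nonnegativity and symmetry for all arguments of the type.
\<close>
definition lifted_dist ::
  "'a::metric_space set \<Rightarrow> 'a \<Rightarrow> (real \<Rightarrow> 'a) set \<Rightarrow> (real \<Rightarrow> 'a) set \<Rightarrow> real" where
  "lifted_dist M p A B =
     (if A \<in> lip_path_space M p \<and> B \<in> lip_path_space M p
      then Inf {path_length \<beta> | \<beta> \<gamma>\<^sub>1 \<gamma>\<^sub>2.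
             \<gamma>\<^sub>1 \<in> A \<and> \<gamma>\<^sub>2 \<in> B \<and> lip_homotopic M \<beta> (reversepath \<gamma>\<^sub>1 +++ \<gamma>\<^sub>2)}
      else 0)"

text \<open>The product is \<open>[\<alpha>] \<otimes> [\<beta>] = [\<alpha> +++ \<beta>]\<close>, written without choosing representatives.\<close>
definition lip_pi1 :: "'a::metric_space set \<Rightarrow> 'a \<Rightarrow> (real \<Rightarrow> 'a) set monoid" where
  "lip_pi1 M p =
     \<lparr>carrier = {lip_class M \<gamma> | \<gamma>. lip_path M \<gamma> \<and> pathstart \<gamma> = p \<and> pathfinish \<gamma> = p},
      monoid.mult = (\<lambda>A B. \<Union>\<alpha>\<in>A. \<Union>\<beta>\<in>B. lip_class M (\<alpha> +++ \<beta>)),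
      one = lip_class M (\<lambda>_. p)\<rparr>"

definition locally_representable ::
  "'a::metric_space set \<Rightarrow> 'a \<Rightarrow> (real \<Rightarrow> 'a) set \<Rightarrow> bool" where
  "locally_representable M p A \<longleftrightarrow>
     A \<in> carrier (lip_pi1 M p) \<and>
     (\<forall>U\<subseteq>M. (\<exists>V. openin (top_of_set M) V \<and> p \<in> V \<and> V \<subseteq> U) \<longrightarrow>
        (\<exists>\<alpha>\<in>A. path_image \<alpha> \<subseteq> U))"

definition only_trivial_local_representation :: "'a::metric_space set \<Rightarrow> 'a \<Rightarrow> bool" where
  "only_trivial_local_representation M p \<longleftrightarrow>
     {A. locally_representable M p A} = {lip_class M (\<lambda>_. p)}"

definition metric_group :: "('g, 'b) monoid_scheme \<Rightarrow> ('g \<Rightarrow> 'g \<Rightarrow> real) \<Rightarrow> bool" where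
  "metric_group G d \<longleftrightarrow>
     group G \<and> Metric_space (carrier G) d \<and>
     (\<forall>g\<in>carrier G. \<forall>x\<in>carrier G. \<forall>y\<in>carrier G.
        d (g \<otimes>\<^bsub>G\<^esub> x) (g \<otimes>\<^bsub>G\<^esub> y) = d x y)"

end

theory Submission
  imports Defs
begin

text \<open>
  On the fundamental group the lifted metric comes from a single function of one variable. Let
  \<open>\<ell>(A)\<close> be the infimum of the lengths of the loops in the class \<open>A\<close>. Since \<open>d([\<alpha>], [\<beta>])\<close> is the
  infimum of the lengths of the loops homotopic to the inverse of \<open>\<alpha>\<close> followed by \<open>\<beta>\<close>, it equals
  \<open>\<ell>([\<alpha>]\<inverse> [\<beta>])\<close> (\<open>lifted_dist_eq_class_length\<close>). From here on the argument is the standard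
  construction of a left-invariant metric from a norm on a group. Left invariance is the identity
  \<open>(gx)\<inverse>(gy) = x\<inverse>y\<close>. The triangle inequality is \<open>\<ell>(AB) \<le> \<ell>(A) + \<ell>(B)\<close>, which holds because
  lengths add under concatenation (\<open>class_length_mult\<close>). Symmetry holds because reversal
  preserves length.
  
  Definiteness is the only point at which the hypothesis on the base point enters. If \<open>\<ell>(A) = 0\<close>,
  then \<open>A\<close> contains arbitrarily short loops. A loop stays within its length of its base point, so
  \<open>A\<close> has a representative in every neighbourhood of the base point
  (\<open>locally_representable_if_class_length_zero\<close>), and by hypothesis \<open>A\<close> is trivial.
  
  The group axioms need explicit homotopies. Associativity, the neutral element and inverses all
  compare two reparametrizations of one path with the same ends, and a single straight-line
  homotopy in the parameter serves for all three (\<open>lip_homotopic_reparametrizations\<close>).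
\<close>

section \<open>Lipschitz paths and homotopies\<close>

lemma lip_pathI:
  assumes "C-lipschitz_on {0..1} \<gamma>" and "\<And>s. s \<in> {0..1} \<Longrightarrow> \<gamma> s \<in> M"
  shows "lip_path M \<gamma>"
  using assms unfolding lip_path_def path_image_def by blast

lemma lip_pathD: "lip_path M \<gamma> \<Longrightarrow> s \<in> {0..1} \<Longrightarrow> \<gamma> s \<in> M"
  unfolding lip_path_def path_image_def by blast

lemma lipschitz_on_joinpaths:
  assumes "C-lipschitz_on {0..1} \<alpha>" and "C-lipschitz_on {0..1} \<beta>"
    and "pathfinish \<alpha> = pathstart \<beta>"
  shows "(2 * C)-lipschitz_on {0..1} (\<alpha> +++ \<beta>)"
proof -
  have "2-lipschitz_on {0..1/2} (\<lambda>x::real. 2 * x)" "2-lipschitz_on {1/2..1} (\<lambda>x::real. 2 * x - 1)"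
    by (auto intro!: lipschitz_on_leI simp: dist_real_def)
  then have "(C * 2)-lipschitz_on {0..1/2} (\<lambda>x. \<alpha> (2 * x))"
    and "(C * 2)-lipschitz_on {1/2..1} (\<lambda>x. \<beta> (2 * x - 1))"
    by (intro lipschitz_on_compose2 lipschitz_on_subset[OF assms(1)] lipschitz_on_subset[OF assms(2)];
        auto)+
  then have "(C * 2)-lipschitz_on {0..1} (\<alpha> +++ \<beta>)"
    unfolding joinpaths_def using assms(3)
    by (intro lipschitz_on_concat) (auto simp: pathstart_def pathfinish_def)
  then show ?thesis by (simp add: mult.commute)
qed

lemma lipschitz_on_reversepath:
  assumes "C-lipschitz_on {0..1} \<alpha>"
  shows "C-lipschitz_on {0..1} (reversepath \<alpha>)"
proof (rule lipschitz_onI)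
  fix x y :: real assume "x \<in> {0..1}" "y \<in> {0..1}"
  then show "dist (reversepath \<alpha> x) (reversepath \<alpha> y) \<le> C * dist x y"
    using lipschitz_onD[OF assms, of "1 - x" "1 - y"]
    by (simp add: reversepath_def dist_real_def abs_minus_commute)
qed (rule lipschitz_on_nonneg[OF assms])

lemma lip_path_joinpaths:
  assumes "lip_path M \<alpha>" and "lip_path M \<beta>" and "pathfinish \<alpha> = pathstart \<beta>"
  shows "lip_path M (\<alpha> +++ \<beta>)"
proof -
  obtain C D where "C-lipschitz_on {0..1} \<alpha>" "D-lipschitz_on {0..1} \<beta>"
    using assms unfolding lip_path_def by blast
  then have "(max C D)-lipschitz_on {0..1} \<alpha>" "(max C D)-lipschitz_on {0..1} \<beta>"
    by (auto intro: lipschitz_on_le)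
  then show ?thesis
    using assms lipschitz_on_joinpaths path_image_join unfolding lip_path_def
    by (metis Un_least)
qed

lemma lip_path_reversepath: "lip_path M \<alpha> \<Longrightarrow> lip_path M (reversepath \<alpha>)"
  unfolding lip_path_def using lipschitz_on_reversepath by auto

lemma lip_path_const: "p \<in> M \<Longrightarrow> lip_path M (\<lambda>_. p)"
  by (rule lip_pathI[where C = 0]) (auto intro: lipschitz_onI)

text \<open>
  The Lipschitz condition is imposed on the horizontal and vertical slices separately, with one
  constant. By the triangle inequality this is equivalent to being Lipschitz for the \<open>L\<^sup>1\<close> metric
  on the square, and slices are easy to handle: they are again paths, so gluing two homotopies
  along an edge reduces to concatenating paths.
\<close>
definition lip_homotopy ::
  "'a::metric_space set \<Rightarrow> real \<Rightarrow> (real \<Rightarrow> real \<Rightarrow> 'a) \<Rightarrow> (real \<Rightarrow> 'a) \<Rightarrow> (real \<Rightarrow> 'a) \<Rightarrow> bool" where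
  "lip_homotopy M C H \<gamma> \<gamma>' \<longleftrightarrow>
     (\<forall>s\<in>{0..1}. \<forall>t\<in>{0..1}. H s t \<in> M) \<and>
     (\<forall>t\<in>{0..1}. C-lipschitz_on {0..1} (\<lambda>s. H s t)) \<and>
     (\<forall>s\<in>{0..1}. C-lipschitz_on {0..1} (H s)) \<and>
     (\<forall>s\<in>{0..1}. H s 0 = \<gamma> s) \<and> (\<forall>s\<in>{0..1}. H s 1 = \<gamma>' s) \<and>
     (\<forall>t\<in>{0..1}. H 0 t = \<gamma> 0) \<and> (\<forall>t\<in>{0..1}. H 1 t = \<gamma> 1)"

lemma lip_homotopyI:
  assumes "\<And>s t. s \<in> {0..1} \<Longrightarrow> t \<in> {0..1} \<Longrightarrow> H s t \<in> M"
    and "\<And>t. t \<in> {0..1} \<Longrightarrow> C-lipschitz_on {0..1} (\<lambda>s. H s t)"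
    and "\<And>s. s \<in> {0..1} \<Longrightarrow> C-lipschitz_on {0..1} (H s)"
    and "\<And>s. s \<in> {0..1} \<Longrightarrow> H s 0 = \<gamma> s" "\<And>s. s \<in> {0..1} \<Longrightarrow> H s 1 = \<gamma>' s"
    and "\<And>t. t \<in> {0..1} \<Longrightarrow> H 0 t = \<gamma> 0" "\<And>t. t \<in> {0..1} \<Longrightarrow> H 1 t = \<gamma> 1"
  shows "lip_homotopy M C H \<gamma> \<gamma>'"
  using assms unfolding lip_homotopy_def by blast

lemma lip_homotopyD:
  assumes "lip_homotopy M C H \<gamma> \<gamma>'"
  shows "\<And>s t. s \<in> {0..1} \<Longrightarrow> t \<in> {0..1} \<Longrightarrow> H s t \<in> M"
    and "\<And>t. t \<in> {0..1} \<Longrightarrow> C-lipschitz_on {0..1} (\<lambda>s. H s t)"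
    and "\<And>s. s \<in> {0..1} \<Longrightarrow> C-lipschitz_on {0..1} (H s)"
    and "\<And>s. s \<in> {0..1} \<Longrightarrow> H s 0 = \<gamma> s" "\<And>s. s \<in> {0..1} \<Longrightarrow> H s 1 = \<gamma>' s"
    and "\<And>t. t \<in> {0..1} \<Longrightarrow> H 0 t = \<gamma> 0" "\<And>t. t \<in> {0..1} \<Longrightarrow> H 1 t = \<gamma> 1"
  using assms unfolding lip_homotopy_def by blast+

lemma lip_homotopy_mono: "lip_homotopy M C H \<gamma> \<gamma>' \<Longrightarrow> C \<le> D \<Longrightarrow> lip_homotopy M D H \<gamma> \<gamma>'"
  unfolding lip_homotopy_def by (blast intro: lipschitz_on_le)

lemma lip_homotopic_if_lip_homotopy:
  assumes "lip_homotopy M C H \<gamma> \<gamma>'"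
  shows "lip_homotopic M \<gamma> \<gamma>'"
proof -
  note H = lip_homotopyD[OF assms]
  have C: "C \<ge> 0" by (rule lipschitz_on_nonneg[OF H(2)[of 0]]) simp
  have "C-lipschitz_on {0..1} \<gamma>" "C-lipschitz_on {0..1} \<gamma>'"
    by (rule lipschitz_on_transform[OF H(2)[of 0]]; simp add: H(4))
       (rule lipschitz_on_transform[OF H(2)[of 1]]; simp add: H(5))
  moreover have "\<gamma> s \<in> M" "\<gamma>' s \<in> M" if "s \<in> {0..1}" for s
    using H(1)[of s 0] H(1)[of s 1] H(4,5)[of s] that by auto
  ultimately have "lip_path M \<gamma>" "lip_path M \<gamma>'" by (auto intro: lip_pathI)
  moreover have "\<gamma> 0 = \<gamma>' 0" "\<gamma> 1 = \<gamma>' 1"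
    using H(6)[of 1] H(7)[of 1] H(5)[of 0] H(5)[of 1] by auto
  moreover have "dist (H s t) (H s' t') \<le> C * (\<bar>s - s'\<bar> + \<bar>t - t'\<bar>)"
    if "s \<in> {0..1}" "t \<in> {0..1}" "s' \<in> {0..1}" "t' \<in> {0..1}" for s t s' t'
  proof -
    have "dist (H s t) (H s' t') \<le> dist (H s t) (H s' t) + dist (H s' t) (H s' t')"
      by (rule dist_triangle)
    also have "\<dots> \<le> C * \<bar>s - s'\<bar> + C * \<bar>t - t'\<bar>"
      using lipschitz_onD[OF H(2)[OF that(2)] that(1,3)] lipschitz_onD[OF H(3)[OF that(3)] that(2,4)]
      by (simp add: dist_real_def)
    finally show ?thesis by (simp add: algebra_simps)
  qed
  ultimately show ?thesis
    unfolding lip_homotopic_def pathstart_def pathfinish_def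
    using C H by (intro conjI exI[of _ H] exI[of _ C] ballI) auto
qed

lemma lip_homotopic_iff_lip_homotopy:
  "lip_homotopic M \<gamma> \<gamma>' \<longleftrightarrow> (\<exists>C H. lip_homotopy M C H \<gamma> \<gamma>')"
proof
  assume "lip_homotopic M \<gamma> \<gamma>'"
  then obtain H C where H: "\<forall>s\<in>{0..1}. \<forall>t\<in>{0..1}. H s t \<in> M" "(C::real) \<ge> 0"
    "\<forall>s\<in>{0..1}. \<forall>t\<in>{0..1}. \<forall>s'\<in>{0..1}. \<forall>t'\<in>{0..1}.
       dist (H s t) (H s' t') \<le> C * (\<bar>s - s'\<bar> + \<bar>t - t'\<bar>)"
    "\<forall>s\<in>{0..1}. H s 0 = \<gamma> s" "\<forall>s\<in>{0..1}. H s 1 = \<gamma>' s"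
    "\<forall>t\<in>{0..1}. H 0 t = \<gamma> 0" "\<forall>t\<in>{0..1}. H 1 t = \<gamma> 1"
    unfolding lip_homotopic_def by blast
  have "C-lipschitz_on {0..1} (\<lambda>s. H s t)" "C-lipschitz_on {0..1} (H t)" if "t \<in> {0..1}" for t
    using H(2,3) that by (fastforce intro!: lipschitz_onI simp: dist_real_def)+
  then show "\<exists>C H. lip_homotopy M C H \<gamma> \<gamma>'"
    using H unfolding lip_homotopy_def by blast
qed (blast intro: lip_homotopic_if_lip_homotopy)

lemma lip_homotopic_ends:
  assumes "lip_homotopic M \<gamma> \<gamma>'"
  shows "lip_path M \<gamma>" "lip_path M \<gamma>'" "pathstart \<gamma>' = pathstart \<gamma>" "pathfinish \<gamma>' = pathfinish \<gamma>"
  using assms by (auto simp: lip_homotopic_def)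

text \<open>
  The parameters \<open>\<phi>\<close> and \<open>\<psi>\<close> are joined by the segment \<open>(1 - t) \<phi> + t \<psi>\<close> inside the convex set
  \<open>[0,1]\<close>, so the homotopy moves along the trace of \<open>\<gamma>\<close> and stays in \<open>M\<close>.
\<close>
lemma lip_homotopic_reparametrizations:
  assumes \<gamma>: "lip_path M \<gamma>"
    and lip: "K-lipschitz_on {0..1} \<phi>" "K-lipschitz_on {0..1} \<psi>"
    and range: "\<And>s. s \<in> {0..1} \<Longrightarrow> \<phi> s \<in> {0..1}" "\<And>s. s \<in> {0..1} \<Longrightarrow> \<psi> s \<in> {0..1}"
    and ends: "\<phi> 0 = \<psi> 0" "\<phi> 1 = \<psi> 1"
    and eq: "\<And>s. s \<in> {0..1} \<Longrightarrow> \<alpha> s = \<gamma> (\<phi> s)" "\<And>s. s \<in> {0..1} \<Longrightarrow> \<beta> s = \<gamma> (\<psi> s)"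
  shows "lip_homotopic M \<alpha> \<beta>"
proof -
  obtain C where C: "C-lipschitz_on {0..1} \<gamma>"
    using \<gamma> unfolding lip_path_def by blast
  have pos: "C \<ge> 0" "K \<ge> 0" using C lip lipschitz_on_nonneg by blast+
  define u where "u s t = (1 - t) * \<phi> s + t * \<psi> s" for s t :: real
  have u01: "u s t \<in> {0..1}" if "s \<in> {0..1}" "t \<in> {0..1}" for s t
    using range[OF that(1)] that(2) convex_bound_le[of "\<phi> s" 1 "\<psi> s" "1 - t" t]
    by (auto simp: u_def)
  (* The parameter u is K-Lipschitz in s and 1-Lipschitz in t, so K + 1 serves for both. *)
  have lip_comp: "(C * (K + 1))-lipschitz_on {0..1} (\<lambda>x. \<gamma> (v x))"
    if v: "\<And>x. x \<in> {0..1} \<Longrightarrow> v x \<in> {0..1}" "(K + 1)-lipschitz_on {0..1} v" for v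
    using v(1) by (intro lipschitz_on_compose2[OF v(2)] lipschitz_on_subset[OF C]) blast
  have u_s: "(K + 1)-lipschitz_on {0..1} (\<lambda>s. u s t)" if t: "t \<in> {0..1}" for t
  proof (rule lipschitz_onI)
    fix x y :: real assume "x \<in> {0..1}" "y \<in> {0..1}"
    then have "\<bar>\<phi> x - \<phi> y\<bar> \<le> K * \<bar>x - y\<bar>" "\<bar>\<psi> x - \<psi> y\<bar> \<le> K * \<bar>x - y\<bar>"
      using lip lipschitz_onD by (fastforce simp: dist_real_def)+
    then have "(1 - t) * \<bar>\<phi> x - \<phi> y\<bar> + t * \<bar>\<psi> x - \<psi> y\<bar> \<le> K * \<bar>x - y\<bar>"
      using t by (intro convex_bound_le) auto
    also have "\<dots> \<le> (K + 1) * \<bar>x - y\<bar>" by (intro mult_right_mono) auto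
    finally have "(1 - t) * \<bar>\<phi> x - \<phi> y\<bar> + t * \<bar>\<psi> x - \<psi> y\<bar> \<le> (K + 1) * \<bar>x - y\<bar>" .
    moreover have "u x t - u y t = (1 - t) * (\<phi> x - \<phi> y) + t * (\<psi> x - \<psi> y)"
      by (simp add: u_def algebra_simps)
    then have "\<bar>u x t - u y t\<bar> \<le> (1 - t) * \<bar>\<phi> x - \<phi> y\<bar> + t * \<bar>\<psi> x - \<psi> y\<bar>"
      using t abs_triangle_ineq[of "(1 - t) * (\<phi> x - \<phi> y)" "t * (\<psi> x - \<psi> y)"]
      by (simp add: abs_mult)
    ultimately show "dist (u x t) (u y t) \<le> (K + 1) * dist x y"
      unfolding dist_real_def by linarith
  qed (use pos in simp)
  have u_t: "(K + 1)-lipschitz_on {0..1} (u s)" if s: "s \<in> {0..1}" for s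
  proof (rule lipschitz_onI)
    fix x y :: real
    have "u s x - u s y = (\<psi> s - \<phi> s) * (x - y)" by (simp add: u_def algebra_simps)
    then have "\<bar>u s x - u s y\<bar> = \<bar>\<psi> s - \<phi> s\<bar> * \<bar>x - y\<bar>" by (simp add: abs_mult)
    also have "\<dots> \<le> (K + 1) * \<bar>x - y\<bar>"
      using range[OF s] pos by (intro mult_right_mono) auto
    finally show "dist (u s x) (u s y) \<le> (K + 1) * dist x y" by (simp add: dist_real_def)
  qed (use pos in simp)
  show ?thesis
  proof (rule lip_homotopic_if_lip_homotopy[OF lip_homotopyI, where H = "\<lambda>s t. \<gamma> (u s t)" and C = "C * (K + 1)"])
    show "\<gamma> (u s t) \<in> M" if "s \<in> {0..1}" "t \<in> {0..1}" for s t
      using lip_pathD[OF \<gamma> u01[OF that]] .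
    show "(C * (K + 1))-lipschitz_on {0..1} (\<lambda>s. \<gamma> (u s t))" if "t \<in> {0..1}" for t
      using lip_comp[of "\<lambda>s. u s t"] u_s u01 that by blast
    show "(C * (K + 1))-lipschitz_on {0..1} (\<lambda>t. \<gamma> (u s t))" if "s \<in> {0..1}" for s
      using lip_comp[of "u s"] u_t u01 that by blast
  qed (auto simp: u_def eq ends algebra_simps)
qed

lemma lip_homotopic_refl:
  assumes "lip_path M \<gamma>"
  shows "lip_homotopic M \<gamma> \<gamma>"
  by (rule lip_homotopic_reparametrizations[OF assms, where \<phi> = "\<lambda>s. s" and \<psi> = "\<lambda>s. s" and K = 1])
     (auto intro: lipschitz_onI)

lemma lip_homotopic_sym:
  assumes "lip_homotopic M \<gamma> \<gamma>'"
  shows "lip_homotopic M \<gamma>' \<gamma>"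
proof -
  have ends: "\<gamma>' 0 = \<gamma> 0" "\<gamma>' 1 = \<gamma> 1"
    using lip_homotopic_ends[OF assms] by (auto simp: pathstart_def pathfinish_def)
  obtain C H where H0: "lip_homotopy M C H \<gamma> \<gamma>'"
    using assms unfolding lip_homotopic_iff_lip_homotopy by blast
  note H = lip_homotopyD[OF H0]
  show ?thesis
  proof (rule lip_homotopic_if_lip_homotopy[OF lip_homotopyI, where H = "\<lambda>s. reversepath (H s)" and C = C])
    show "C-lipschitz_on {0..1} (reversepath (H s))" if "s \<in> {0..1}" for s
      using lipschitz_on_reversepath H(3) that by blast
  qed (auto simp: reversepath_def ends intro: H)
qed

lemma lip_homotopic_trans:
  assumes "lip_homotopic M \<alpha> \<beta>" and "lip_homotopic M \<beta> \<gamma>"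
  shows "lip_homotopic M \<alpha> \<gamma>"
proof -
  have ends: "\<beta> 0 = \<alpha> 0" "\<beta> 1 = \<alpha> 1"
    using lip_homotopic_ends[OF assms(1)] by (auto simp: pathstart_def pathfinish_def)
  obtain C H where H0: "lip_homotopy M C H \<alpha> \<beta>"
    using assms(1) unfolding lip_homotopic_iff_lip_homotopy by blast
  obtain D G where G0: "lip_homotopy M D G \<beta> \<gamma>"
    using assms(2) unfolding lip_homotopic_iff_lip_homotopy by blast
  define E where "E = max C D"
  note H = lip_homotopyD[OF lip_homotopy_mono[OF H0, of E]]
    and G = lip_homotopyD[OF lip_homotopy_mono[OF G0, of E]]
  have E: "C \<le> E" "D \<le> E" by (auto simp: E_def)
  have le: "E \<le> 2 * E" using lipschitz_on_nonneg[OF H(3)[of 0]] E by simp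
  (* The homotopies are stacked vertically: concatenation takes place in the parameter t. *)
  show ?thesis
  proof (rule lip_homotopic_if_lip_homotopy[OF lip_homotopyI, where H = "\<lambda>s. H s +++ G s" and C = "2 * E"])
    show "(2 * E)-lipschitz_on {0..1} (H s +++ G s)" if "s \<in> {0..1}" for s
      using that E by (intro lipschitz_on_joinpaths H G) (auto simp: pathfinish_def pathstart_def H G)
    show "(2 * E)-lipschitz_on {0..1} (\<lambda>s. (H s +++ G s) t)" if "t \<in> {0..1}" for t
      using that E lipschitz_on_le[OF H(2)[of "2 * t"] le] lipschitz_on_le[OF G(2)[of "2 * t - 1"] le]
      by (cases "t \<le> 1/2") (auto simp: joinpaths_def)
  qed (auto simp: joinpaths_def ends H G E)
qed

lemma lip_homotopic_joinpaths:
  assumes "lip_homotopic M \<alpha> \<alpha>'" and "lip_homotopic M \<beta> \<beta>'" and "pathfinish \<alpha> = pathstart \<beta>"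
  shows "lip_homotopic M (\<alpha> +++ \<beta>) (\<alpha>' +++ \<beta>')"
proof -
  have mid: "\<alpha> 1 = \<beta> 0" using assms(3) by (simp add: pathstart_def pathfinish_def)
  obtain C H where H0: "lip_homotopy M C H \<alpha> \<alpha>'"
    using assms(1) unfolding lip_homotopic_iff_lip_homotopy by blast
  obtain D G where G0: "lip_homotopy M D G \<beta> \<beta>'"
    using assms(2) unfolding lip_homotopic_iff_lip_homotopy by blast
  define E where "E = max C D"
  note H = lip_homotopyD[OF lip_homotopy_mono[OF H0, of E]]
    and G = lip_homotopyD[OF lip_homotopy_mono[OF G0, of E]]
  have E: "C \<le> E" "D \<le> E" by (auto simp: E_def)
  have le: "E \<le> 2 * E" using lipschitz_on_nonneg[OF H(3)[of 0]] E by simp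
  show ?thesis
  proof (rule lip_homotopic_if_lip_homotopy[OF lip_homotopyI, where H = "\<lambda>s t. ((\<lambda>s. H s t) +++ (\<lambda>s. G s t)) s" and C = "2 * E"])
    show "(2 * E)-lipschitz_on {0..1} ((\<lambda>s. H s t) +++ (\<lambda>s. G s t))" if "t \<in> {0..1}" for t
      using that E mid
      by (intro lipschitz_on_joinpaths H G) (auto simp: pathfinish_def pathstart_def H G)
    show "(2 * E)-lipschitz_on {0..1} (\<lambda>t. ((\<lambda>s. H s t) +++ (\<lambda>s. G s t)) s)" if "s \<in> {0..1}" for s
      using that E lipschitz_on_le[OF H(3)[of "2 * s"] le] lipschitz_on_le[OF G(3)[of "2 * s - 1"] le]
      by (cases "s \<le> 1/2") (auto simp: joinpaths_def)
  qed (auto simp: joinpaths_def H G E)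
qed

lemma lip_homotopic_reversepath:
  assumes "lip_homotopic M \<alpha> \<alpha>'"
  shows "lip_homotopic M (reversepath \<alpha>) (reversepath \<alpha>')"
proof -
  obtain C H where H0: "lip_homotopy M C H \<alpha> \<alpha>'"
    using assms unfolding lip_homotopic_iff_lip_homotopy by blast
  note H = lip_homotopyD[OF H0]
  show ?thesis
  proof (rule lip_homotopic_if_lip_homotopy[OF lip_homotopyI, where H = "\<lambda>s. H (1 - s)" and C = C])
    show "C-lipschitz_on {0..1} (\<lambda>s. H (1 - s) t)" if "t \<in> {0..1}" for t
      using lipschitz_on_reversepath[OF H(2)[OF that]] by (simp add: reversepath_def)
  qed (auto simp: reversepath_def intro: H)
qed

text \<open>
  Both bracketings run through the same three paths. They differ by the piecewise linear map of
  \<open>[0,1]\<close> that carries the break points \<open>1/4\<close>, \<open>1/2\<close> to \<open>1/2\<close>, \<open>3/4\<close>.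
\<close>
lemma lip_homotopic_assoc:
  assumes "lip_path M \<alpha>" "lip_path M \<beta>" "lip_path M \<gamma>"
    and "pathfinish \<alpha> = pathstart \<beta>" "pathfinish \<beta> = pathstart \<gamma>"
  shows "lip_homotopic M ((\<alpha> +++ \<beta>) +++ \<gamma>) (\<alpha> +++ (\<beta> +++ \<gamma>))"
proof (rule lip_homotopic_reparametrizations[where \<gamma> = "\<alpha> +++ (\<beta> +++ \<gamma>)" and K = 2
      and \<phi> = "\<lambda>s. if s \<le> 1/4 then 2 * s else if s \<le> 1/2 then s + 1/4 else s/2 + 1/2" and \<psi> = "\<lambda>s. s"])
  show "lip_path M (\<alpha> +++ \<beta> +++ \<gamma>)"
    using assms by (simp add: lip_path_joinpaths)
  show "2-lipschitz_on {0..1} (\<lambda>s::real. if s \<le> 1/4 then 2 * s else if s \<le> 1/2 then s + 1/4 else s/2 + 1/2)"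
  proof (rule lipschitz_on_leI)
    fix x y :: real assume "x \<le> y"
    then show "dist (if x \<le> 1/4 then 2 * x else if x \<le> 1/2 then x + 1/4 else x/2 + 1/2)
       (if y \<le> 1/4 then 2 * y else if y \<le> 1/2 then y + 1/4 else y/2 + 1/2) \<le> 2 * dist x y"
      by (simp add: dist_real_def split: if_split)
  qed simp
  show "2-lipschitz_on {0..1} (\<lambda>s::real. s)"
    by (rule lipschitz_onI) simp_all
qed (auto simp: joinpaths_def)

lemma lip_homotopic_const_joinpaths:
  assumes "lip_path M \<gamma>" and "pathstart \<gamma> = p"
  shows "lip_homotopic M ((\<lambda>_. p) +++ \<gamma>) \<gamma>"
proof (rule lip_homotopic_reparametrizations[OF assms(1), where K = 2
      and \<phi> = "\<lambda>s. if s \<le> 1/2 then 0 else 2 * s - 1" and \<psi> = "\<lambda>s. s"])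
  show "2-lipschitz_on {0..1} (\<lambda>s::real. if s \<le> 1/2 then 0 else 2 * s - 1)"
  proof (rule lipschitz_on_leI)
    fix x y :: real assume "x \<le> y"
    then show "dist (if x \<le> 1/2 then 0 else 2 * x - 1) (if y \<le> 1/2 then 0 else 2 * y - 1)
        \<le> 2 * dist x y"
      by (simp add: dist_real_def split: if_split)
  qed simp
  show "2-lipschitz_on {0..1} (\<lambda>s::real. s)"
    by (rule lipschitz_onI) simp_all
  show "((\<lambda>_. p) +++ \<gamma>) s = \<gamma> (if s \<le> 1/2 then 0 else 2 * s - 1)" for s
    using assms(2) by (simp add: joinpaths_def pathstart_def)
qed auto

text \<open>
  The path \<open>reversepath \<gamma> +++ \<gamma>\<close> is \<open>\<gamma>\<close> with the parameter moving from 1 down to 0 and back to 1,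
  and such a parameter can be contracted to the constant 1.
\<close>
lemma lip_homotopic_reversepath_joinpaths:
  assumes "lip_path M \<gamma>"
  shows "lip_homotopic M (reversepath \<gamma> +++ \<gamma>) (\<lambda>_. pathfinish \<gamma>)"
proof (rule lip_homotopic_reparametrizations[OF assms(1), where K = 2
      and \<phi> = "\<lambda>s. if s \<le> 1/2 then 1 - 2 * s else 2 * s - 1" and \<psi> = "\<lambda>s. 1"])
  show "2-lipschitz_on {0..1} (\<lambda>s::real. if s \<le> 1/2 then 1 - 2 * s else 2 * s - 1)"
  proof (rule lipschitz_on_leI)
    fix x y :: real assume "x \<le> y"
    then show "dist (if x \<le> 1/2 then 1 - 2 * x else 2 * x - 1)
        (if y \<le> 1/2 then 1 - 2 * y else 2 * y - 1) \<le> 2 * dist x y"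
      by (auto simp: dist_real_def abs_le_iff)
  qed simp
  show "2-lipschitz_on {0..1} (\<lambda>s::real. 1::real)"
    by (rule lipschitz_onI) simp_all
  show "(reversepath \<gamma> +++ \<gamma>) s = \<gamma> (if s \<le> 1/2 then 1 - 2 * s else 2 * s - 1)" for s
    by (simp add: joinpaths_def reversepath_def)
  show "pathfinish \<gamma> = \<gamma> 1"
    by (simp add: pathfinish_def)
qed auto

section \<open>The length of a path\<close>

text \<open>
  A supremum of reals bounds its set only when the set is bounded above. Here the Lipschitz constant
  is a bound, since the increments of a partition sum to 1.
\<close>
lemma sum_dist_le_path_length:
  assumes "lip_path M \<gamma>" and "t 0 = 0" "t n = 1" "\<forall>i<n. t i \<le> t (Suc i)"
  shows "(\<Sum>i<n. dist (\<gamma> (t i)) (\<gamma> (t (Suc i)))) \<le> path_length \<gamma>"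
  unfolding path_length_def
proof (rule cSup_upper)
  obtain C where C: "C-lipschitz_on {0..1} \<gamma>"
    using assms(1) unfolding lip_path_def by blast
  have "(\<Sum>i<n. dist (\<gamma> (t i)) (\<gamma> (t (Suc i)))) \<le> C"
    if t: "t 0 = 0" "t n = 1" "\<forall>i<n. t i \<le> t (Suc i)" for t :: "nat \<Rightarrow> real" and n
  proof -
    have mono: "t i \<le> t j" if "i \<le> j" "j \<le> n" for i j
      using that
    proof (induction rule: dec_induct)
      case (step k)
      then show ?case using t(3)[rule_format, of k] by linarith
    qed simp
    have t01: "t i \<in> {0..1}" if "i \<le> n" for i
      using mono[of 0 i] mono[of i n] t that by auto
    have "(\<Sum>i<n. dist (\<gamma> (t i)) (\<gamma> (t (Suc i)))) \<le> (\<Sum>i<n. C * (t (Suc i) - t i))"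
    proof (rule sum_mono)
      fix i assume "i \<in> {..<n}"
      then show "dist (\<gamma> (t i)) (\<gamma> (t (Suc i))) \<le> C * (t (Suc i) - t i)"
        using lipschitz_onD[OF C t01[of i] t01[of "Suc i"]] t(3) by (simp add: dist_real_def)
    qed
    also have "\<dots> = C"
      using t(1,2) by (simp flip: sum_distrib_left add: sum_lessThan_telescope)
    finally show ?thesis .
  qed
  then show "bdd_above {\<Sum>i<n. dist (\<gamma> (t i)) (\<gamma> (t (Suc i))) |(t::nat \<Rightarrow> real) n.
      t 0 = 0 \<and> t n = 1 \<and> (\<forall>i<n. t i \<le> t (Suc i))}"
    by (intro bdd_aboveI[of _ C]) blast
qed (use assms in blast)

lemma path_length_le:
  assumes "\<And>(t::nat \<Rightarrow> real) n. t 0 = 0 \<Longrightarrow> t n = 1 \<Longrightarrow> \<forall>i<n. t i \<le> t (Suc i) \<Longrightarrow>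
    (\<Sum>i<n. dist (\<gamma> (t i)) (\<gamma> (t (Suc i)))) \<le> K"
  shows "path_length \<gamma> \<le> K"
  unfolding path_length_def
proof (rule cSup_least)
  show "{\<Sum>i<n. dist (\<gamma> (t i)) (\<gamma> (t (Suc i))) |(t::nat \<Rightarrow> real) n.
      t 0 = 0 \<and> t n = 1 \<and> (\<forall>i<n. t i \<le> t (Suc i))} \<noteq> {}"
    by (rule ex_in_conv[THEN iffD1], intro exI CollectI exI[of _ real] exI[of _ 1]) auto
qed (use assms in auto)

text \<open>
  This confines a loop to the ball around its base point whose radius is its length.
\<close>
lemma dist_le_path_length:
  assumes "lip_path M \<gamma>" and "s \<in> {0..1}"
  shows "dist (pathstart \<gamma>) (\<gamma> s) \<le> path_length \<gamma>"
proof -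
  (* The partition with the points 0, s, 1. *)
  define t where "t i = (if i = 0 then 0 else if i = 1 then s else 1)" for i :: nat
  have "(\<Sum>i<2. dist (\<gamma> (t i)) (\<gamma> (t (Suc i)))) \<le> path_length \<gamma>"
    using assms(2) by (intro sum_dist_le_path_length[OF assms(1)]) (auto simp: t_def)
  then have "dist (\<gamma> 0) (\<gamma> s) + dist (\<gamma> s) (\<gamma> 1) \<le> path_length \<gamma>"
    by (simp add: t_def numeral_2_eq_2)
  then show ?thesis
    using zero_le_dist[of "\<gamma> s" "\<gamma> 1"] unfolding pathstart_def by linarith
qed

lemma path_length_nonneg: "lip_path M \<gamma> \<Longrightarrow> 0 \<le> path_length \<gamma>"
  using dist_le_path_length[of M \<gamma> 0] by (simp add: pathstart_def)

lemma path_length_const: "path_length (\<lambda>_. p) \<le> 0"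
  by (rule path_length_le) simp

lemma path_length_reversepath_le:
  assumes "lip_path M \<gamma>"
  shows "path_length (reversepath \<gamma>) \<le> path_length \<gamma>"
proof (rule path_length_le)
  fix t :: "nat \<Rightarrow> real" and n
  assume t: "t 0 = 0" "t n = 1" "\<forall>i<n. t i \<le> t (Suc i)"
  define u where "u i = 1 - t (n - i)" for i
  have "(\<Sum>i<n. dist (reversepath \<gamma> (t i)) (reversepath \<gamma> (t (Suc i))))
      = (\<Sum>i<n. dist (reversepath \<gamma> (t (n - Suc i))) (reversepath \<gamma> (t (Suc (n - Suc i)))))"
    by (rule sum.nat_diff_reindex[symmetric])
  also have "\<dots> = (\<Sum>i<n. dist (\<gamma> (u i)) (\<gamma> (u (Suc i))))"
    by (intro sum.cong) (auto simp: u_def reversepath_def dist_commute Suc_diff_Suc)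
  also have "\<dots> \<le> path_length \<gamma>"
  proof (rule sum_dist_le_path_length[OF assms])
    show "\<forall>i<n. u i \<le> u (Suc i)"
    proof (intro allI impI)
      fix i assume "i < n"
      then show "u i \<le> u (Suc i)"
        using t(3)[rule_format, of "n - Suc i"] by (simp add: u_def Suc_diff_Suc)
    qed
  qed (simp_all add: u_def t)
  finally show "(\<Sum>i<n. dist (reversepath \<gamma> (t i)) (reversepath \<gamma> (t (Suc i)))) \<le> path_length \<gamma>" .
qed

lemma path_length_reversepath:
  assumes "lip_path M \<gamma>"
  shows "path_length (reversepath \<gamma>) = path_length \<gamma>"
  using path_length_reversepath_le[OF assms]
    path_length_reversepath_le[OF lip_path_reversepath[OF assms]] by simp

text \<open>
  A partition \<open>t\<close> need not contain the point \<open>1/2\<close>. Instead of refining it, each of its points is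
  pushed into both halves, by \<open>min 1 (2 t)\<close> for \<open>\<alpha>\<close> and \<open>max 0 (2 t - 1)\<close> for \<open>\<beta>\<close>. This gives two
  partitions of \<open>[0,1]\<close> of the same size, and an interval that crosses \<open>1/2\<close> is split by the
  triangle inequality at the common end point.
\<close>
lemma path_length_joinpaths_le:
  assumes "lip_path M \<alpha>" and "lip_path M \<beta>" and "pathfinish \<alpha> = pathstart \<beta>"
  shows "path_length (\<alpha> +++ \<beta>) \<le> path_length \<alpha> + path_length \<beta>"
proof (rule path_length_le)
  fix t :: "nat \<Rightarrow> real" and n
  assume t: "t 0 = 0" "t n = 1" "\<forall>i<n. t i \<le> t (Suc i)"
  define u v where "u i = min 1 (2 * t i)" and "v i = max 0 (2 * t i - 1)" for i
  have mid: "\<alpha> 1 = \<beta> 0" using assms(3) by (simp add: pathstart_def pathfinish_def)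
  have "dist ((\<alpha> +++ \<beta>) (t i)) ((\<alpha> +++ \<beta>) (t (Suc i)))
      \<le> dist (\<alpha> (u i)) (\<alpha> (u (Suc i))) + dist (\<beta> (v i)) (\<beta> (v (Suc i)))" if "i < n" for i
  proof -
    have "t i \<le> t (Suc i)" using t(3) that by blast
    then consider "t (Suc i) \<le> 1/2" "t i \<le> 1/2" | "t i \<le> 1/2" "1/2 < t (Suc i)"
      | "1/2 < t i" "1/2 < t (Suc i)"
      by linarith
    then show ?thesis
    proof cases
      case 2
      then show ?thesis
        using dist_triangle[of "\<alpha> (2 * t i)" "\<beta> (2 * t (Suc i) - 1)" "\<alpha> 1"]
        by (simp add: joinpaths_def u_def v_def mid)
    qed (simp_all add: joinpaths_def u_def v_def)
  qed
  then have "(\<Sum>i<n. dist ((\<alpha> +++ \<beta>) (t i)) ((\<alpha> +++ \<beta>) (t (Suc i))))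
      \<le> (\<Sum>i<n. dist (\<alpha> (u i)) (\<alpha> (u (Suc i)))) + (\<Sum>i<n. dist (\<beta> (v i)) (\<beta> (v (Suc i))))"
    unfolding sum.distrib[symmetric] by (intro sum_mono) simp
  also have "\<dots> \<le> path_length \<alpha> + path_length \<beta>"
  proof (rule add_mono)
    show "(\<Sum>i<n. dist (\<alpha> (u i)) (\<alpha> (u (Suc i)))) \<le> path_length \<alpha>"
    proof (rule sum_dist_le_path_length[OF assms(1)])
      show "\<forall>i<n. u i \<le> u (Suc i)" using t(3) unfolding u_def by (intro allI impI min.mono) simp_all
    qed (simp_all add: u_def t)
    show "(\<Sum>i<n. dist (\<beta> (v i)) (\<beta> (v (Suc i)))) \<le> path_length \<beta>"
    proof (rule sum_dist_le_path_length[OF assms(2)])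
      show "\<forall>i<n. v i \<le> v (Suc i)" using t(3) unfolding v_def by (intro allI impI max.mono) simp_all
    qed (simp_all add: v_def t)
  qed
  finally show "(\<Sum>i<n. dist ((\<alpha> +++ \<beta>) (t i)) ((\<alpha> +++ \<beta>) (t (Suc i))))
      \<le> path_length \<alpha> + path_length \<beta>" .
qed

section \<open>The Lipschitz fundamental group\<close>

lemma lip_class_eq:
  assumes "lip_homotopic M \<alpha> \<beta>"
  shows "lip_class M \<alpha> = lip_class M \<beta>"
proof -
  have "lip_homotopic M \<alpha> \<gamma> \<longleftrightarrow> lip_homotopic M \<beta> \<gamma>" for \<gamma>
    using lip_homotopic_trans[OF assms] lip_homotopic_trans[OF lip_homotopic_sym[OF assms]] by blast
  then show ?thesis by (simp add: lip_class_def)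
qed

lemma lip_class_self: "lip_path M \<gamma> \<Longrightarrow> \<gamma> \<in> lip_class M \<gamma>"
  by (simp add: lip_class_def lip_homotopic_refl)

lemma lip_pi1_carrierI:
  "lip_path M \<gamma> \<Longrightarrow> pathstart \<gamma> = p \<Longrightarrow> pathfinish \<gamma> = p \<Longrightarrow> lip_class M \<gamma> \<in> carrier (lip_pi1 M p)"
  by (auto simp: lip_pi1_def)

lemma lip_pi1_carrierE:
  assumes "A \<in> carrier (lip_pi1 M p)"
  obtains \<gamma> where "A = lip_class M \<gamma>" "lip_path M \<gamma>" "pathstart \<gamma> = p" "pathfinish \<gamma> = p"
  using assms by (auto simp: lip_pi1_def)

lemma lip_pi1_elemD:
  assumes "A \<in> carrier (lip_pi1 M p)" and "\<gamma> \<in> A"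
  shows "A = lip_class M \<gamma>" "lip_path M \<gamma>" "pathstart \<gamma> = p" "pathfinish \<gamma> = p"
proof -
  obtain \<gamma>' where \<gamma>': "A = lip_class M \<gamma>'" "lip_path M \<gamma>'" "pathstart \<gamma>' = p" "pathfinish \<gamma>' = p"
    using assms(1) by (rule lip_pi1_carrierE)
  then have h: "lip_homotopic M \<gamma>' \<gamma>" using assms(2) by (simp add: lip_class_def)
  show "A = lip_class M \<gamma>" using lip_class_eq[OF h] \<gamma>'(1) by simp
  show "lip_path M \<gamma>" "pathstart \<gamma> = p" "pathfinish \<gamma> = p"
    using lip_homotopic_ends[OF h] \<gamma>' by auto
qed

text \<open>
  The product is a union over all pairs of representatives. Concatenation respects homotopy, so
  all members of the union coincide.
\<close>
lemma lip_pi1_mult: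
  assumes "lip_path M \<alpha>" and "lip_path M \<beta>" and "pathfinish \<alpha> = pathstart \<beta>"
  shows "lip_class M \<alpha> \<otimes>\<^bsub>lip_pi1 M p\<^esub> lip_class M \<beta> = lip_class M (\<alpha> +++ \<beta>)"
proof -
  have "lip_class M (\<alpha>' +++ \<beta>') = lip_class M (\<alpha> +++ \<beta>)"
    if "\<alpha>' \<in> lip_class M \<alpha>" "\<beta>' \<in> lip_class M \<beta>" for \<alpha>' \<beta>'
    using that assms(3) lip_class_eq[OF lip_homotopic_joinpaths[of M \<alpha> \<alpha>' \<beta> \<beta>']]
    by (simp add: lip_class_def)
  then have "(\<Union>\<alpha>'\<in>lip_class M \<alpha>. \<Union>\<beta>'\<in>lip_class M \<beta>. lip_class M (\<alpha>' +++ \<beta>'))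
      = (\<Union>\<alpha>'\<in>lip_class M \<alpha>. \<Union>\<beta>'\<in>lip_class M \<beta>. lip_class M (\<alpha> +++ \<beta>))"
    by simp
  also have "\<dots> = lip_class M (\<alpha> +++ \<beta>)"
    using lip_class_self[OF assms(1)] lip_class_self[OF assms(2)] by blast
  finally show ?thesis by (simp add: lip_pi1_def)
qed

lemma lip_pi1_one: "\<one>\<^bsub>lip_pi1 M p\<^esub> = lip_class M (\<lambda>_. p)"
  by (simp add: lip_pi1_def)

lemma pathstart_finish_const: "pathstart (\<lambda>_. p) = p" "pathfinish (\<lambda>_. p) = p"
  by (simp_all add: pathstart_def pathfinish_def)

lemma lip_pi1_l_inv:
  assumes "lip_path M \<gamma>" "pathstart \<gamma> = p" "pathfinish \<gamma> = p"
  shows "lip_class M (reversepath \<gamma>) \<otimes>\<^bsub>lip_pi1 M p\<^esub> lip_class M \<gamma> = \<one>\<^bsub>lip_pi1 M p\<^esub>"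
  using assms lip_class_eq[OF lip_homotopic_reversepath_joinpaths[OF assms(1)]]
  by (simp add: lip_pi1_mult lip_path_reversepath lip_pi1_one)

lemma group_lip_pi1:
  assumes "p \<in> M"
  shows "group (lip_pi1 M p)"
proof (rule groupI)
  show "\<one>\<^bsub>lip_pi1 M p\<^esub> \<in> carrier (lip_pi1 M p)"
    using assms by (simp add: lip_pi1_one lip_pi1_carrierI lip_path_const pathstart_finish_const)
next
  fix A B assume "A \<in> carrier (lip_pi1 M p)" "B \<in> carrier (lip_pi1 M p)"
  then show "A \<otimes>\<^bsub>lip_pi1 M p\<^esub> B \<in> carrier (lip_pi1 M p)"
    by (elim lip_pi1_carrierE) (simp add: lip_pi1_mult lip_pi1_carrierI lip_path_joinpaths)
next
  fix A B C
  assume "A \<in> carrier (lip_pi1 M p)" "B \<in> carrier (lip_pi1 M p)" "C \<in> carrier (lip_pi1 M p)"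
  then show "A \<otimes>\<^bsub>lip_pi1 M p\<^esub> B \<otimes>\<^bsub>lip_pi1 M p\<^esub> C = A \<otimes>\<^bsub>lip_pi1 M p\<^esub> (B \<otimes>\<^bsub>lip_pi1 M p\<^esub> C)"
    by (elim lip_pi1_carrierE)
       (simp add: lip_pi1_mult lip_path_joinpaths lip_class_eq[OF lip_homotopic_assoc])
next
  fix A assume "A \<in> carrier (lip_pi1 M p)"
  then obtain \<gamma> where \<gamma>: "A = lip_class M \<gamma>" "lip_path M \<gamma>" "pathstart \<gamma> = p" "pathfinish \<gamma> = p"
    by (rule lip_pi1_carrierE)
  show "\<one>\<^bsub>lip_pi1 M p\<^esub> \<otimes>\<^bsub>lip_pi1 M p\<^esub> A = A"
    using \<gamma> assms lip_class_eq[OF lip_homotopic_const_joinpaths[OF \<gamma>(2,3)]]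
    by (simp add: lip_pi1_one lip_pi1_mult lip_path_const pathstart_finish_const)
  show "\<exists>B\<in>carrier (lip_pi1 M p). B \<otimes>\<^bsub>lip_pi1 M p\<^esub> A = \<one>\<^bsub>lip_pi1 M p\<^esub>"
    using \<gamma> lip_pi1_l_inv[OF \<gamma>(2-4)]
    by (intro bexI[of _ "lip_class M (reversepath \<gamma>)"])
       (simp_all add: lip_pi1_carrierI lip_path_reversepath)
qed

lemma lip_pi1_inv:
  assumes "p \<in> M" and "lip_path M \<gamma>" "pathstart \<gamma> = p" "pathfinish \<gamma> = p"
  shows "inv\<^bsub>lip_pi1 M p\<^esub> lip_class M \<gamma> = lip_class M (reversepath \<gamma>)"
  using group.inv_equality[OF group_lip_pi1[OF assms(1)] lip_pi1_l_inv[OF assms(2-4)]] assms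
  by (simp add: lip_pi1_carrierI lip_path_reversepath)

section \<open>The infimum of the lengths in a class\<close>

text \<open>
  This is the group norm from which the lifted metric arises. The infimum need not be attained.
\<close>
definition class_length :: "(real \<Rightarrow> 'a::metric_space) set \<Rightarrow> real" where
  "class_length A = Inf (path_length ` A)"

lemma bdd_below_path_length_image:
  assumes "A \<in> carrier (lip_pi1 M p)"
  shows "bdd_below (path_length ` A)"
  by (rule bdd_belowI2[of _ 0]) (rule path_length_nonneg[OF lip_pi1_elemD(2)[OF assms]])

lemma class_length_le:
  assumes "A \<in> carrier (lip_pi1 M p)" and "\<gamma> \<in> A"
  shows "class_length A \<le> path_length \<gamma>"
  unfolding class_length_def
  by (rule cINF_lower[OF bdd_below_path_length_image[OF assms(1)] assms(2)])

lemma class_length_less: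
  assumes "A \<in> carrier (lip_pi1 M p)" and "class_length A < e"
  obtains \<gamma> where "\<gamma> \<in> A" "path_length \<gamma> < e"
proof -
  obtain \<alpha> where "\<alpha> \<in> A"
    using assms(1) lip_class_self by (metis lip_pi1_carrierE)
  then have "\<exists>x\<in>path_length ` A. x < e"
    using assms(2) unfolding class_length_def
    by (subst (asm) cInf_less_iff) (use bdd_below_path_length_image[OF assms(1)] in auto)
  then show ?thesis using that by blast
qed

lemma class_length_one:
  assumes "p \<in> M"
  shows "class_length \<one>\<^bsub>lip_pi1 M p\<^esub> \<le> 0"
proof -
  have "class_length (lip_class M (\<lambda>_. p)) \<le> path_length (\<lambda>_. p)"
    using assms by (intro class_length_le[of _ M p])
      (simp_all add: lip_pi1_carrierI lip_class_self lip_path_const pathstart_finish_const)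
  then show ?thesis using path_length_const[of p] by (simp add: lip_pi1_one)
qed

lemma class_length_mult:
  assumes "p \<in> M" and A: "A \<in> carrier (lip_pi1 M p)" and B: "B \<in> carrier (lip_pi1 M p)"
  shows "class_length (A \<otimes>\<^bsub>lip_pi1 M p\<^esub> B) \<le> class_length A + class_length B"
proof (rule field_le_epsilon)
  fix e :: real assume "0 < e"
  then have less: "class_length A < class_length A + e / 2" "class_length B < class_length B + e / 2"
    by simp_all
  obtain \<alpha> where \<alpha>: "\<alpha> \<in> A" "path_length \<alpha> < class_length A + e / 2"
    using class_length_less[OF A less(1)] .
  obtain \<beta> where \<beta>: "\<beta> \<in> B" "path_length \<beta> < class_length B + e / 2"
    using class_length_less[OF B less(2)] .
  note a = lip_pi1_elemD[OF A \<alpha>(1)] and b = lip_pi1_elemD[OF B \<beta>(1)]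
  have AB: "A \<otimes>\<^bsub>lip_pi1 M p\<^esub> B = lip_class M (\<alpha> +++ \<beta>)"
    unfolding a(1) b(1) using a b by (simp add: lip_pi1_mult)
  have "class_length (lip_class M (\<alpha> +++ \<beta>)) \<le> path_length (\<alpha> +++ \<beta>)"
    using a b by (intro class_length_le[of _ M p])
      (simp_all add: lip_pi1_carrierI lip_class_self lip_path_joinpaths)
  also have "\<dots> \<le> path_length \<alpha> + path_length \<beta>"
    using a b by (intro path_length_joinpaths_le) simp_all
  finally show "class_length (A \<otimes>\<^bsub>lip_pi1 M p\<^esub> B) \<le> class_length A + class_length B + e"
    using \<alpha>(2) \<beta>(2) unfolding AB by linarith
qed

text \<open>
  A class of norm 0 contains loops shorter than any \<open>e > 0\<close>, and such a loop lies in the ball of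
  radius \<open>e\<close> around its base point.
\<close>
lemma locally_representable_if_class_length_zero:
  assumes A: "A \<in> carrier (lip_pi1 M p)" and "class_length A \<le> 0"
  shows "locally_representable M p A"
  unfolding locally_representable_def
proof (intro conjI A allI impI)
  fix U assume "\<exists>V. openin (top_of_set M) V \<and> p \<in> V \<and> V \<subseteq> U"
  then obtain V where V: "openin (top_of_set M) V" "p \<in> V" "V \<subseteq> U" by blast
  then obtain e where "e > 0" "ball p e \<inter> M \<subseteq> V"
    unfolding openin_contains_ball by blast
  with V(3) have e: "e > 0" "ball p e \<inter> M \<subseteq> U" by simp_all
  from e(1) assms(2) have "class_length A < e" by simp
  then obtain \<gamma> where \<gamma>: "\<gamma> \<in> A" "path_length \<gamma> < e"
    using class_length_less[OF A] by blast
  note g = lip_pi1_elemD[OF A \<gamma>(1)]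
  have "\<gamma> s \<in> ball p e \<inter> M" if "s \<in> {0..1}" for s
    using dist_le_path_length[OF g(2) that] g \<gamma>(2) lip_pathD[OF g(2) that] by simp
  then have "path_image \<gamma> \<subseteq> U"
    using e(2) by (auto simp: path_image_def)
  then show "\<exists>\<gamma>\<in>A. path_image \<gamma> \<subseteq> U"
    using \<gamma>(1) by blast
qed

section \<open>The lifted metric\<close>

text \<open>
  Reversing a path homotopic to \<open>reversepath \<alpha> +++ \<gamma>\<close> gives one of the same length homotopic to
  \<open>reversepath \<gamma> +++ \<alpha>\<close>, so the two infima are over the same set of lengths. The paths in the
  classes need not be loops here, since \<^locale>\<open>Metric_space\<close> asks for symmetry and nonnegativity
  at all arguments, not only on the carrier.
\<close>
lemma lifted_dist_commute: "lifted_dist M p A B = lifted_dist M p B A"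
proof -
  have sub: "{path_length \<beta> |\<beta> \<gamma>\<^sub>1 \<gamma>\<^sub>2.
        \<gamma>\<^sub>1 \<in> A \<and> \<gamma>\<^sub>2 \<in> B \<and> lip_homotopic M \<beta> (reversepath \<gamma>\<^sub>1 +++ \<gamma>\<^sub>2)}
     \<subseteq> {path_length \<beta> |\<beta> \<gamma>\<^sub>1 \<gamma>\<^sub>2.
        \<gamma>\<^sub>1 \<in> B \<and> \<gamma>\<^sub>2 \<in> A \<and> lip_homotopic M \<beta> (reversepath \<gamma>\<^sub>1 +++ \<gamma>\<^sub>2)}"
    if AB: "A \<in> lip_path_space M p" "B \<in> lip_path_space M p" for A B
  proof clarify
    fix \<beta> \<alpha> \<gamma>
    assume \<alpha>: "\<alpha> \<in> A" and \<gamma>: "\<gamma> \<in> B" and h: "lip_homotopic M \<beta> (reversepath \<alpha> +++ \<gamma>)"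
    have start: "pathstart \<alpha> = p" "pathstart \<gamma> = p"
      using AB \<alpha> \<gamma> lip_homotopic_ends(3)
      by (fastforce simp: lip_path_space_def lip_class_def)+
    have "reversepath (reversepath \<alpha> +++ \<gamma>) = reversepath \<gamma> +++ \<alpha>"
      using start by (simp add: reversepath_joinpaths)
    then have "lip_homotopic M (reversepath \<beta>) (reversepath \<gamma> +++ \<alpha>)"
      using lip_homotopic_reversepath[OF h] by simp
    then show "\<exists>\<beta>' \<gamma>\<^sub>1 \<gamma>\<^sub>2. path_length \<beta> = path_length \<beta>' \<and> \<gamma>\<^sub>1 \<in> B \<and> \<gamma>\<^sub>2 \<in> A \<and>
        lip_homotopic M \<beta>' (reversepath \<gamma>\<^sub>1 +++ \<gamma>\<^sub>2)"
      using \<alpha> \<gamma> path_length_reversepath[OF lip_homotopic_ends(1)[OF h]] by metis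
  qed
  show ?thesis
  proof (cases "A \<in> lip_path_space M p \<and> B \<in> lip_path_space M p")
    case True
    then show ?thesis
      using sub[of A B] sub[of B A] unfolding lifted_dist_def by (simp add: subset_antisym)
  qed (auto simp: lifted_dist_def)
qed

lemma lifted_dist_nonneg: "0 \<le> lifted_dist M p A B"
proof (cases "A \<in> lip_path_space M p \<and> B \<in> lip_path_space M p")
  case True
  then obtain \<alpha> \<beta> where \<alpha>: "A = lip_class M \<alpha>" "lip_path M \<alpha>" "pathstart \<alpha> = p"
    and \<beta>: "B = lip_class M \<beta>" "lip_path M \<beta>" "pathstart \<beta> = p"
    unfolding lip_path_space_def by blast
  have refl: "lip_homotopic M (reversepath \<alpha> +++ \<beta>) (reversepath \<alpha> +++ \<beta>)"
    using \<alpha> \<beta> by (simp add: lip_homotopic_refl lip_path_joinpaths lip_path_reversepath)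
  have "0 \<le> Inf {path_length \<beta> | \<beta> \<gamma>\<^sub>1 \<gamma>\<^sub>2.
      \<gamma>\<^sub>1 \<in> A \<and> \<gamma>\<^sub>2 \<in> B \<and> lip_homotopic M \<beta> (reversepath \<gamma>\<^sub>1 +++ \<gamma>\<^sub>2)}" (is "0 \<le> Inf ?S")
  proof (rule cInf_greatest)
    have "path_length (reversepath \<alpha> +++ \<beta>) \<in> ?S"
      using refl \<alpha> \<beta> lip_class_self by blast
    then show "?S \<noteq> {}" by blast
    show "0 \<le> x" if "x \<in> ?S" for x
      using that path_length_nonneg[OF lip_homotopic_ends(1)] by blast
  qed
  with True show ?thesis by (simp add: lifted_dist_def)
qed (auto simp: lifted_dist_def)

text \<open>
  Every choice of representatives \<open>\<gamma>\<^sub>1\<close>, \<open>\<gamma>\<^sub>2\<close> in the definition of the lifted metric gives the same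
  homotopy class \<open>[\<gamma>\<^sub>1]\<inverse> [\<gamma>\<^sub>2]\<close>, so the infimum is over the loops of that one class.
\<close>
lemma lifted_dist_eq_class_length:
  assumes "p \<in> M" and A: "A \<in> carrier (lip_pi1 M p)" and B: "B \<in> carrier (lip_pi1 M p)"
  shows "lifted_dist M p A B = class_length (inv\<^bsub>lip_pi1 M p\<^esub> A \<otimes>\<^bsub>lip_pi1 M p\<^esub> B)"
proof -
  have quotient: "inv\<^bsub>lip_pi1 M p\<^esub> A \<otimes>\<^bsub>lip_pi1 M p\<^esub> B = lip_class M (reversepath \<alpha> +++ \<beta>)"
    if "\<alpha> \<in> A" "\<beta> \<in> B" for \<alpha> \<beta>
    using lip_pi1_elemD[OF A that(1)] lip_pi1_elemD[OF B that(2)] assms(1)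
    by (simp add: lip_pi1_inv lip_pi1_mult lip_path_reversepath)
  obtain \<alpha> \<beta> where "\<alpha> \<in> A" "\<beta> \<in> B"
    using A B lip_class_self by (metis lip_pi1_carrierE)
  have "lip_homotopic M \<beta> (reversepath \<gamma>\<^sub>1 +++ \<gamma>\<^sub>2) \<longleftrightarrow> \<beta> \<in> inv\<^bsub>lip_pi1 M p\<^esub> A \<otimes>\<^bsub>lip_pi1 M p\<^esub> B"
    if "\<gamma>\<^sub>1 \<in> A" "\<gamma>\<^sub>2 \<in> B" for \<beta> \<gamma>\<^sub>1 \<gamma>\<^sub>2
    unfolding quotient[OF that] lip_class_def using lip_homotopic_sym by blast
  then have "{path_length \<beta> | \<beta> \<gamma>\<^sub>1 \<gamma>\<^sub>2.
      \<gamma>\<^sub>1 \<in> A \<and> \<gamma>\<^sub>2 \<in> B \<and> lip_homotopic M \<beta> (reversepath \<gamma>\<^sub>1 +++ \<gamma>\<^sub>2)}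
      = {path_length \<beta> | \<beta> \<gamma>\<^sub>1 \<gamma>\<^sub>2.
      \<gamma>\<^sub>1 \<in> A \<and> \<gamma>\<^sub>2 \<in> B \<and> \<beta> \<in> inv\<^bsub>lip_pi1 M p\<^esub> A \<otimes>\<^bsub>lip_pi1 M p\<^esub> B}"
    by (intro Collect_cong ex_cong1 conj_cong) simp_all
  also have "\<dots> = path_length ` (inv\<^bsub>lip_pi1 M p\<^esub> A \<otimes>\<^bsub>lip_pi1 M p\<^esub> B)"
    using \<open>\<alpha> \<in> A\<close> \<open>\<beta> \<in> B\<close> by blast
  finally have "{path_length \<beta> | \<beta> \<gamma>\<^sub>1 \<gamma>\<^sub>2.
      \<gamma>\<^sub>1 \<in> A \<and> \<gamma>\<^sub>2 \<in> B \<and> lip_homotopic M \<beta> (reversepath \<gamma>\<^sub>1 +++ \<gamma>\<^sub>2)}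
      = path_length ` (inv\<^bsub>lip_pi1 M p\<^esub> A \<otimes>\<^bsub>lip_pi1 M p\<^esub> B)" .
  moreover have "A \<in> lip_path_space M p" "B \<in> lip_path_space M p"
    using A B by (auto simp: lip_pi1_def lip_path_space_def)
  ultimately show ?thesis by (simp add: lifted_dist_def class_length_def)
qed

theorem corollary2p12:
  fixes M :: "'a::metric_space set" and p0 :: 'a
  assumes "p0 \<in> M"
    and "lip_path_connected M"
    and "\<exists>x\<in>M. \<exists>y\<in>M. x \<noteq> y"
    and "only_trivial_local_representation M p0"
  shows "metric_group (lip_pi1 M p0) (lifted_dist M p0)"
proof -
  interpret group "lip_pi1 M p0" by (rule group_lip_pi1[OF assms(1)])
  let ?G = "lip_pi1 M p0" and ?d = "lifted_dist M p0"
  note d = lifted_dist_eq_class_length[OF assms(1)]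
  have metric: "Metric_space (carrier ?G) ?d"
  proof
    fix A B C
    show "0 \<le> ?d A B" by (rule lifted_dist_nonneg)
    show "?d A B = ?d B A" by (rule lifted_dist_commute)
    assume A: "A \<in> carrier ?G" and B: "B \<in> carrier ?G"
    show "?d A B = 0 \<longleftrightarrow> A = B"
    proof
      assume "?d A B = 0"
      then have "locally_representable M p0 (inv\<^bsub>?G\<^esub> A \<otimes>\<^bsub>?G\<^esub> B)"
        using A B by (intro locally_representable_if_class_length_zero) (simp_all add: d)
      then have "inv\<^bsub>?G\<^esub> A \<otimes>\<^bsub>?G\<^esub> B = \<one>\<^bsub>?G\<^esub>"
        using assms(4) unfolding only_trivial_local_representation_def lip_pi1_one by blast
      then show "A = B"
        using A B by (metis inv_closed inv_equality inv_inv)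
    next
      assume "A = B"
      then show "?d A B = 0"
        using A class_length_one[OF assms(1)] lifted_dist_nonneg[of M p0 A B] by (simp add: d)
    qed
    assume C: "C \<in> carrier ?G"
    have "inv\<^bsub>?G\<^esub> A \<otimes>\<^bsub>?G\<^esub> C = (inv\<^bsub>?G\<^esub> A \<otimes>\<^bsub>?G\<^esub> B) \<otimes>\<^bsub>?G\<^esub> (inv\<^bsub>?G\<^esub> B \<otimes>\<^bsub>?G\<^esub> C)"
      using A B C by (simp add: m_assoc r_inv flip: m_assoc[of B])
    then show "?d A C \<le> ?d A B + ?d B C"
      using A B C class_length_mult[OF assms(1)] by (simp add: d)
  qed
  have "?d (g \<otimes>\<^bsub>?G\<^esub> x) (g \<otimes>\<^bsub>?G\<^esub> y) = ?d x y"
    if "g \<in> carrier ?G" "x \<in> carrier ?G" "y \<in> carrier ?G" for g x y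
  proof -
    have "inv\<^bsub>?G\<^esub> (g \<otimes>\<^bsub>?G\<^esub> x) \<otimes>\<^bsub>?G\<^esub> (g \<otimes>\<^bsub>?G\<^esub> y) = inv\<^bsub>?G\<^esub> x \<otimes>\<^bsub>?G\<^esub> (inv\<^bsub>?G\<^esub> g \<otimes>\<^bsub>?G\<^esub> (g \<otimes>\<^bsub>?G\<^esub> y))"
      using that by (simp add: inv_mult_group m_assoc)
    also have "\<dots> = inv\<^bsub>?G\<^esub> x \<otimes>\<^bsub>?G\<^esub> y"
      using that by (simp flip: m_assoc)
    finally show ?thesis using that by (simp add: d)
  qed
  with metric is_group show ?thesis by (simp add: metric_group_def)
qed

end
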